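(* Let $A$ be a complex $n\times n$ matrix whose eigenvalues are all real, and let $B=A-\frac{\operatorname{tr}A}{n}I$. Then $$\operatorname{spd}(A)\ge \left(\frac{4}{n^2}\left(n\operatorname{tr}B^4+3(\operatorname{tr}B^2)^2\right)\right)^{1/4}.$$ Moreover, if $n$ is odd and $n\ge 3$, then $$\operatorname{spd}(A)\ge \left(\frac{4}{n^2-1}\left(n\operatorname{tr}B^4+3(\operatorname{tr}B^2)^2\right)\right)^{1/4}.$$
   Context: $\operatorname{spd}(A)$ denotes the spread of $A$, i.e. $\operatorname{spd}(A)=\max_{i,j}|\lambda_i(A)-\lambda_j(A)|$, where $\lambda_1(A),\dots,\lambda_n(A)$ are the eigenvalues of $A$; for real eigenvalues this is the largest minus the smallest eigenvalue. The matrix $A$ is not assumed to be Hermitian; $I$ is the $n\times n$ identity matrix. *)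

theory Defs
  imports "Jordan_Normal_Form.Spectral_Radius" "HOL-Library.Nonpos_Ints"
begin

definition mat_trace :: "'a :: comm_monoid_add mat \<Rightarrow> 'a" where
  "mat_trace A = (\<Sum>i<dim_row A. A $$ (i, i))"

(* Multiplicities do not affect the maximum, so the set of eigenvalues suffices.
   For a square complex matrix of positive dimension this set is finite and nonempty. *)
definition spd :: "complex mat \<Rightarrow> real" where
  "spd A = Max {cmod (k - l) | k l. k \<in> spectrum A \<and> l \<in> spectrum A}"

end

theory Submission
  imports Defs "Jordan_Normal_Form.Jordan_Normal_Form_Uniqueness"
begin

text \<open>
  For eigenvalues \<open>x\<^sub>1, \<dots>, x\<^sub>n\<close> with mean \<open>c\<close>, expanding around \<open>c\<close> gives
  \<open>n tr B\<^sup>4 + 3 (tr B\<^sup>2)\<^sup>2 = \<Sum>\<^bsub>i<j\<^esub> (x\<^sub>i - x\<^sub>j)\<^sup>4\<close>, since \<open>tr B = 0\<close>. If all \<open>x\<^sub>i\<close> lie in an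
  interval of length \<open>s\<close>, this sum is at most \<open>\<lfloor>n\<^sup>2/4\<rfloor> s\<^sup>4\<close>: remove a smallest and a largest
  point; any remaining \<open>z\<close> contributes \<open>(z - min)\<^sup>4 + (max - z)\<^sup>4 \<le> s\<^sup>4\<close>, so the two removed
  points account for at most \<open>(n - 1) s\<^sup>4\<close>, which is exactly the growth of \<open>\<lfloor>n\<^sup>2/4\<rfloor>\<close>
  from \<open>n - 2\<close> to \<open>n\<close>.
\<close>

section \<open>Sums of fourth powers of pairwise differences\<close>

lemma power4_add_le:
  fixes u v s :: real
  assumes "0 \<le> u" "0 \<le> v" "u + v \<le> s"
  shows "u ^ 4 + v ^ 4 \<le> s ^ 4"
proof -
  have "(u + v) ^ 4 = u ^ 4 + v ^ 4 + (4 * u ^ 3 * v + 6 * u\<^sup>2 * v\<^sup>2 + 4 * u * v ^ 3)"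
    by (simp add: power2_eq_square power3_eq_cube power4_eq_xxxx algebra_simps)
  moreover have "4 * u ^ 3 * v + 6 * u\<^sup>2 * v\<^sup>2 + 4 * u * v ^ 3 \<ge> 0"
    using assms by (intro add_nonneg_nonneg mult_nonneg_nonneg) auto
  moreover have "(u + v) ^ 4 \<le> s ^ 4"
    using assms by (intro power_mono) auto
  ultimately show ?thesis by linarith
qed

text \<open>The double sum runs over ordered pairs, so each unordered pair counts twice; hence the
  factor 2.\<close>

lemma sum_diff_power4_le:
  fixes x :: "'i \<Rightarrow> real" and s :: real
  assumes "finite I" "\<And>i j. i \<in> I \<Longrightarrow> j \<in> I \<Longrightarrow> x i - x j \<le> s"
  shows "(\<Sum>i\<in>I. \<Sum>j\<in>I. (x i - x j) ^ 4) \<le> 2 * real ((card I)\<^sup>2 div 4) * s ^ 4"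
  using assms
proof (induction "card I" arbitrary: I rule: less_induct)
  case less
  show ?case
  proof (cases "card I < 2")
    case True
    then have "i = j" if "i \<in> I" "j \<in> I" for i j
      using that less.prems(1) card_le_Suc0_iff_eq[of I] by auto
    then have "(x i - x j) ^ 4 = 0" if "i \<in> I" "j \<in> I" for i j
      using that by fastforce
    then have "(\<Sum>i\<in>I. \<Sum>j\<in>I. (x i - x j) ^ 4) = 0"
      by (intro sum.neutral ballI)
    also have "0 \<le> 2 * real ((card I)\<^sup>2 div 4) * s ^ 4"
      by simp
    finally show ?thesis .
  next
    case False
    then have ne: "I \<noteq> {}" by auto
    have "Min (x ` I) \<in> x ` I"
      using less.prems(1) ne by simp
    then obtain p where p: "p \<in> I" "x p = Min (x ` I)" by auto
    then have p_min: "x p \<le> x i" if "i \<in> I" for i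
      using that less.prems(1) by simp
    have card_p: "card (I - {p}) = card I - 1"
      using p(1) less.prems(1) by simp
    then have ne': "I - {p} \<noteq> {}"
      using False by (intro notI) simp
    \<comment> \<open>Taking the maximum over \<open>I - {p}\<close> keeps \<open>q\<close> distinct
      from \<open>p\<close> even if all values coincide.\<close>
    have "Max (x ` (I - {p})) \<in> x ` (I - {p})"
      using less.prems(1) ne' by (intro Max_in) auto
    then obtain q where q: "q \<in> I - {p}" "x q = Max (x ` (I - {p}))" by (metis imageE)
    then have q_max: "x i \<le> x q" if "i \<in> I - {p}" for i
      using that less.prems(1) by simp
    define J where "J = I - {p} - {q}"
    have fin: "finite J" using less.prems(1) by (simp add: J_def)
    have I: "I = insert p (insert q J)" "p \<notin> insert q J" "q \<notin> J"
      using p q by (auto simp: J_def)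
    have card_I: "card I = card J + 2" using I fin by simp
    have IH: "(\<Sum>i\<in>J. \<Sum>j\<in>J. (x i - x j) ^ 4) \<le> 2 * real ((card J)\<^sup>2 div 4) * s ^ 4"
      using less.hyps[of J] less.prems card_I fin I(1) by auto
    \<comment> \<open>The increment is a multiple of 4, so the floor grows by exactly
      \<open>card J + 1\<close>: one for the pair \<open>p\<close>, \<open>q\<close> and one for
      each point of \<open>J\<close>.\<close>
    have "(card I)\<^sup>2 = (card J)\<^sup>2 + (card J + 1) * 4"
      using card_I by (simp add: power2_eq_square)
    then have floor_step: "(card I)\<^sup>2 div 4 = (card J)\<^sup>2 div 4 + (card J + 1)"
      by simp
    have swap: "(x i - x j) ^ 4 = (x j - x i) ^ 4" for i j
      by (simp add: power4_eq_xxxx algebra_simps)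
    have "(x p - x i) ^ 4 + (x q - x i) ^ 4 \<le> s ^ 4" if "i \<in> J" for i
    proof -
      \<comment> \<open>Both differences are nonnegative and telescope to
        \<open>x q - x p\<close>.\<close>
      have "(x i - x p) ^ 4 + (x q - x i) ^ 4 \<le> s ^ 4"
        using that p_min[of i] q_max[of i] p(1) q(1) less.prems(2)[of q p]
        by (intro power4_add_le) (auto simp: J_def)
      then show ?thesis by (simp only: swap[of p i])
    qed
    then have "(\<Sum>i\<in>J. (x p - x i) ^ 4 + (x q - x i) ^ 4) \<le> (\<Sum>i\<in>J. s ^ 4)"
      by (rule sum_mono)
    moreover have "(x p - x q) ^ 4 \<le> s ^ 4"
      using power4_add_le[of "x q - x p" 0 s] p_min[of q] q(1) less.prems(2)[of q p] p(1) swap[of p q]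
      by simp
    moreover have "(\<Sum>i\<in>I. \<Sum>j\<in>I. (x i - x j) ^ 4) = (\<Sum>i\<in>J. \<Sum>j\<in>J. (x i - x j) ^ 4)
        + 2 * (x p - x q) ^ 4 + 2 * (\<Sum>i\<in>J. (x p - x i) ^ 4 + (x q - x i) ^ 4)"
    proof -
      have "(\<Sum>i\<in>J. (x i - y) ^ 4) = (\<Sum>i\<in>J. (y - x i) ^ 4)" for y
        by (simp add: power4_eq_xxxx algebra_simps)
      then show ?thesis
        using I(2,3) fin unfolding I(1) by (simp add: sum.distrib swap[of q p])
    qed
    ultimately show ?thesis
      using IH unfolding floor_step by (simp add: algebra_simps)
  qed
qed

text \<open>In the binomial expansion the terms of odd degree in \<open>b i\<close> carry the factor
  \<open>\<Sum>i\<in>I. b i\<close>, which vanishes. A general commutative ring allows use with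
  complex diagonal entries.\<close>

lemma sum_diff_power4_centered:
  fixes b :: "'i \<Rightarrow> 'a::comm_ring_1"
  assumes "(\<Sum>i\<in>I. b i) = 0"
  shows "(\<Sum>i\<in>I. \<Sum>j\<in>I. (b i - b j) ^ 4)
    = 2 * (of_nat (card I) * (\<Sum>i\<in>I. b i ^ 4) + 3 * (\<Sum>i\<in>I. (b i)\<^sup>2)\<^sup>2)"
proof -
  \<comment> \<open>Each term is grouped as a factor in \<open>i\<close> times a factor in
    \<open>j\<close>, so that the double sum splits into products of single sums.\<close>
  have "(b i - b j) ^ 4 = b i ^ 4 - b i ^ 3 * (4 * b j) + (b i)\<^sup>2 * (6 * (b j)\<^sup>2)
      - b i * (4 * b j ^ 3) + b j ^ 4" for i j
    by (simp add: power2_eq_square power3_eq_cube power4_eq_xxxx algebra_simps)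
  then have "(\<Sum>i\<in>I. \<Sum>j\<in>I. (b i - b j) ^ 4) = of_nat (card I) * (\<Sum>i\<in>I. b i ^ 4)
      - (\<Sum>i\<in>I. b i ^ 3) * (4 * (\<Sum>i\<in>I. b i)) + (\<Sum>i\<in>I. (b i)\<^sup>2) * (6 * (\<Sum>i\<in>I. (b i)\<^sup>2))
      - (\<Sum>i\<in>I. b i) * (4 * (\<Sum>i\<in>I. b i ^ 3)) + of_nat (card I) * (\<Sum>i\<in>I. b i ^ 4)"
    by (simp add: sum.distrib sum_subtractf flip: sum_distrib_left sum_distrib_right)
  then show ?thesis
    using assms by (simp add: power2_eq_square algebra_simps)
qed

section \<open>Traces of powers and spectra via triangular matrices\<close>

lemma mat_trace_mult_commute:
  fixes A B :: "'a::comm_semiring_0 mat"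
  assumes "A \<in> carrier_mat n m" "B \<in> carrier_mat m n"
  shows "mat_trace (A * B) = mat_trace (B * A)"
proof -
  have "mat_trace (A * B) = (\<Sum>i<n. \<Sum>j<m. A $$ (i, j) * B $$ (j, i))"
    using assms by (simp add: mat_trace_def scalar_prod_def atLeast0LessThan)
  also have "\<dots> = (\<Sum>j<m. \<Sum>i<n. B $$ (j, i) * A $$ (i, j))"
    by (subst sum.swap) (simp add: mult.commute)
  also have "\<dots> = mat_trace (B * A)"
    using assms by (simp add: mat_trace_def scalar_prod_def atLeast0LessThan)
  finally show ?thesis .
qed

lemma mat_trace_similar:
  fixes A B :: "'a::comm_ring_1 mat"
  assumes "similar_mat_wit A B P Q"
  shows "mat_trace A = mat_trace B"
proof -
  note wit = similar_mat_witD[OF refl assms]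
  have "mat_trace A = mat_trace (P * B * Q)"
    using wit(3) by (rule arg_cong)
  also have "\<dots> = mat_trace (Q * (P * B))"
    using wit(5-7) by (intro mat_trace_mult_commute) auto
  also have "Q * (P * B) = Q * P * B"
    using wit(5-7) by (intro assoc_mult_mat[symmetric])
  also have "\<dots> = B"
    using wit(2,5) by simp
  finally show ?thesis .
qed

text \<open>In the entry \<open>(i, j)\<close> of the product, terms with \<open>l < i\<close>
  vanish through \<open>U\<close> and those with \<open>l > j\<close> through \<open>V\<close>; on
  the diagonal only \<open>l = i\<close> survives.\<close>

lemma upper_triangular_mult:
  fixes U V :: "'a::semiring_0 mat"
  assumes U: "U \<in> carrier_mat n n" "upper_triangular U"
    and V: "V \<in> carrier_mat n n" "upper_triangular V"
  shows "upper_triangular (U * V)"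
    and "i < n \<Longrightarrow> (U * V) $$ (i, i) = U $$ (i, i) * V $$ (i, i)"
proof -
  have entry: "(U * V) $$ (i, j) = (\<Sum>l<n. U $$ (i, l) * V $$ (l, j))" if "i < n" "j < n" for i j
    using that U(1) V(1) by (simp add: scalar_prod_def atLeast0LessThan)
  have U0: "U $$ (i, l) = 0" if "l < i" "i < n" for i l
    using that U by auto
  have V0: "V $$ (i, l) = 0" if "l < i" "i < n" for i l
    using that V by auto
  show "upper_triangular (U * V)"
  proof
    fix i j assume ij: "j < i" "i < dim_row (U * V)"
    have "U $$ (i, l) * V $$ (l, j) = 0" if "l < n" for l
      using ij that U0[of l i] V0[of j l] U(1) by (cases "l < i") auto
    then show "(U * V) $$ (i, j) = 0"
      using ij U(1) by (simp add: entry)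
  qed
  assume i: "i < n"
  have "U $$ (i, l) * V $$ (l, i) = 0" if "l < n" "l \<noteq> i" for l
    using i that U0[of l i] V0[of i l] by (cases "l < i") auto
  then have "(\<Sum>l<n. U $$ (i, l) * V $$ (l, i)) = (\<Sum>l\<in>{i}. U $$ (i, l) * V $$ (l, i))"
    using i by (intro sum.mono_neutral_right) auto
  then show "(U * V) $$ (i, i) = U $$ (i, i) * V $$ (i, i)"
    using i by (simp add: entry)
qed

lemma upper_triangular_pow:
  fixes U :: "'a::comm_semiring_1 mat"
  assumes "U \<in> carrier_mat n n" "upper_triangular U"
  shows "upper_triangular (U ^\<^sub>m k) \<and> (\<forall>i<n. (U ^\<^sub>m k) $$ (i, i) = U $$ (i, i) ^ k)"
proof (induction k)
  case 0
  then show ?case using assms(1) by simp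
next
  case (Suc k)
  then show ?case
    using upper_triangular_mult[OF pow_carrier_mat[OF assms(1), of k] _ assms]
    by (simp add: mult.commute)
qed

lemma mat_trace_pow_upper_triangular:
  fixes U :: "'a::comm_semiring_1 mat"
  assumes "U \<in> carrier_mat n n" "upper_triangular U"
  shows "mat_trace (U ^\<^sub>m k) = (\<Sum>i<n. U $$ (i, i) ^ k)"
  using upper_triangular_pow[OF assms, of k] assms(1) pow_carrier_mat[OF assms(1), of k]
  by (simp add: mat_trace_def)

lemma spectrum_upper_triangular:
  fixes U :: "'a::field mat"
  assumes "U \<in> carrier_mat n n" "upper_triangular U"
  shows "spectrum U = (\<lambda>i. U $$ (i, i)) ` {..<n}"
  using assms(1)
  by (auto simp: spectrum_root_char_poly[OF assms(1)] char_poly_upper_triangular[OF assms]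
      poly_prod_list diag_mat_def)

text \<open>\<open>Max\<close> bounds its elements only on a finite set; finiteness comes from that
  of the spectrum.\<close>

lemma eigenvalue_diff_le_spd:
  assumes "A \<in> carrier_mat n n" "k \<in> spectrum A" "l \<in> spectrum A"
  shows "cmod (k - l) \<le> spd A"
proof -
  have "finite ((\<lambda>(k, l). cmod (k - l)) ` (spectrum A \<times> spectrum A))"
    using card_finite_spectrum(1)[OF assms(1)] by auto
  moreover have "(\<lambda>(k, l). cmod (k - l)) ` (spectrum A \<times> spectrum A)
      = {cmod (k - l) | k l. k \<in> spectrum A \<and> l \<in> spectrum A}"
    by auto
  ultimately show ?thesis
    using assms(2,3) unfolding spd_def by (intro Max_ge) auto
qed

text \<open>Schur triangularization turns traces into power sums of eigenvalues. Since
  \<open>S\<close> is a complex number, its membership in the nonnegative reals is what makes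
  \<open>Re S\<close> equal to \<open>S\<close>.\<close>

theorem theorem3p3:
  fixes A B :: "complex mat" and n :: nat and S :: complex
  assumes "n \<ge> 1"
    and "A \<in> carrier_mat n n"
    and "\<And>k. eigenvalue A k \<Longrightarrow> k \<in> \<real>"
    and "B = A - (mat_trace A / of_nat n) \<cdot>\<^sub>m 1\<^sub>m n"
    and "S = of_nat n * mat_trace (B ^\<^sub>m 4) + 3 * (mat_trace (B ^\<^sub>m 2))\<^sup>2"
  shows "S \<in> \<real>\<^sub>\<ge>\<^sub>0
    \<and> spd A \<ge> root 4 (4 / (real n)\<^sup>2 * Re S)
    \<and> (odd n \<and> n \<ge> 3 \<longrightarrow> spd A \<ge> root 4 (4 / ((real n)\<^sup>2 - 1) * Re S))"
proof -
  note A = assms(2)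
  obtain es where "char_poly A = (\<Prod>a\<leftarrow>es. [:- a, 1:])"
    using char_poly_factorized[OF A] by blast
  from schur_decomposition_exists[OF A this] obtain U P Q
    where U: "U \<in> carrier_mat n n" "upper_triangular U" and sim: "similar_mat_wit A U P Q"
    by (auto simp: similar_mat_def)
  have "char_poly A = char_poly U"
    using sim by (intro char_poly_similar) (auto simp: similar_mat_def)
  then have spec: "spectrum A = (\<lambda>i. U $$ (i, i)) ` {..<n}"
    using spectrum_upper_triangular[OF U]
    by (simp add: spectrum_root_char_poly[OF A] spectrum_root_char_poly[OF U(1)])
  define x where "x i = Re (U $$ (i, i))" for i
  have x: "U $$ (i, i) = of_real (x i)" if "i < n" for i
  proof -
    have "U $$ (i, i) \<in> spectrum A" using that spec by auto
    then show ?thesis using assms(3) by (simp add: spectrum_def x_def)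
  qed
  define c where "c = mat_trace A / of_nat n"
  \<comment> \<open>Subtracting \<open>c\<close> times the identity commutes with conjugation, so
    \<open>P\<close> and \<open>Q\<close> also relate \<open>B\<close> to the triangular
    \<open>V\<close>.\<close>
  define V where "V = char_matrix U c"
  have B: "B = char_matrix A c"
    using A by (auto simp: assms(4) c_def char_matrix_def)
  have simV: "similar_mat_wit B V P Q"
    unfolding B V_def by (rule similar_mat_wit_char_matrix[OF sim])
  have V: "V \<in> carrier_mat n n" "upper_triangular V"
    using U by (auto simp: V_def char_matrix_def upper_triangular_def)
  have V_diag: "V $$ (i, i) = U $$ (i, i) - c" if "i < n" for i
    using that U(1) by (simp add: V_def char_matrix_def)
  have trace_pow: "mat_trace (B ^\<^sub>m k) = (\<Sum>i<n. V $$ (i, i) ^ k)" for k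
    using mat_trace_similar[OF similar_mat_wit_pow[OF simV]] mat_trace_pow_upper_triangular[OF V]
    by simp
  have "mat_trace A = (\<Sum>i<n. U $$ (i, i))"
    using mat_trace_similar[OF sim] U(1) by (simp add: mat_trace_def)
  then have "(\<Sum>i<n. V $$ (i, i)) = 0"
    using assms(1) by (simp add: V_diag sum_subtractf c_def)
  then have "2 * S = (\<Sum>i<n. \<Sum>j<n. (V $$ (i, i) - V $$ (j, j)) ^ 4)"
    using sum_diff_power4_centered[of "\<lambda>i. V $$ (i, i)" "{..<n}"] by (simp add: assms(5) trace_pow)
  \<comment> \<open>The shift by \<open>c\<close> cancels in differences, leaving the real
    eigenvalues of \<open>A\<close>.\<close>
  also have "\<dots> = of_real (\<Sum>i<n. \<Sum>j<n. (x i - x j) ^ 4)"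
    by (simp add: V_diag x)
  finally have S: "S = of_real ((\<Sum>i<n. \<Sum>j<n. (x i - x j) ^ 4) / 2)"
    by (simp add: field_simps)
  have "x i - x j \<le> spd A" if "i < n" "j < n" for i j
    using eigenvalue_diff_le_spd[OF A, of "U $$ (i, i)" "U $$ (j, j)"] that spec
    by (auto simp: x simp flip: of_real_diff)
  then have bound: "Re S \<le> real (n\<^sup>2 div 4) * spd A ^ 4"
    using sum_diff_power4_le[of "{..<n}" x "spd A"] by (simp add: S)
  \<comment> \<open>Comparing one eigenvalue with itself shows \<open>spd A\<close> nonnegative, so
    that \<open>root 4\<close> undoes its fourth power.\<close>
  have "0 \<le> cmod (U $$ (0, 0) - U $$ (0, 0))" by simp
  also have "\<dots> \<le> spd A"
    using assms(1) spec by (intro eigenvalue_diff_le_spd[OF A]) auto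
  finally have spd_nonneg: "0 \<le> spd A" .
  \<comment> \<open>Both claims are instances, with \<open>d\<close> equal to \<open>n^2\<close> or
    \<open>n^2 - 1\<close>.\<close>
  have root_le: "root 4 (4 / d * Re S) \<le> spd A" if "0 < d" "4 * real (n\<^sup>2 div 4) \<le> d" for d
  proof -
    have "4 * Re S \<le> 4 * real (n\<^sup>2 div 4) * spd A ^ 4"
      using bound by simp
    also have "\<dots> \<le> d * spd A ^ 4"
      using that(2) by (intro mult_right_mono) auto
    finally have "4 / d * Re S \<le> spd A ^ 4"
      using that(1) by (simp add: field_simps)
    then have "root 4 (4 / d * Re S) \<le> root 4 (spd A ^ 4)"
      by simp
    then show ?thesis
      using spd_nonneg by (simp add: real_root_power_cancel)
  qed
  have "4 * (n\<^sup>2 div 4) \<le> n\<^sup>2" by simp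
  then have "4 * real (n\<^sup>2 div 4) \<le> (real n)\<^sup>2"
    by (metis of_nat_le_iff of_nat_mult of_nat_numeral of_nat_power)
  then have even_bound: "root 4 (4 / (real n)\<^sup>2 * Re S) \<le> spd A"
    using assms(1) by (intro root_le) auto
  have odd_bound: "root 4 (4 / ((real n)\<^sup>2 - 1) * Re S) \<le> spd A" if n: "odd n" "n \<ge> 3"
  proof (rule root_le)
    have "1 < (real n)\<^sup>2" using n by simp
    then show "0 < (real n)\<^sup>2 - 1" by simp
    \<comment> \<open>An odd square is not divisible by 4, so rounding down loses at least
      1.\<close>
    have "odd (n\<^sup>2)" using n by simp
    then have "4 * (n\<^sup>2 div 4) + 1 \<le> n\<^sup>2" by presburger
    then have "real (4 * (n\<^sup>2 div 4) + 1) \<le> real (n\<^sup>2)" by (rule of_nat_mono)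
    then show "4 * real (n\<^sup>2 div 4) \<le> (real n)\<^sup>2 - 1" by simp
  qed
  have "S \<in> \<real>\<^sub>\<ge>\<^sub>0"
    unfolding S nonneg_Reals_of_real_iff by (intro divide_nonneg_nonneg sum_nonneg) auto
  then show ?thesis using even_bound odd_bound by simp
qed

end
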